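(* Let $\Omega$ be a non-empty set, $\vec{\Omega}\colon\mathbb{N}\to\Omega$ a sequence and $B\subseteq\Omega$ with $\underline{P}(B)>0$. Then $\overline{R}(X|B)=\operatorname{GBR}(X|B)$ for every $X\in L^\infty$.
   Context: $L^\infty$ is the Banach space of bounded functions $X\colon\Omega\to\mathbb{R}$ (supremum norm), $(L^\infty)^*$ its dual with the weak* topology, $\chi_A$ the indicator function of $A$, and $\operatorname{PF}(\Omega)=\{E\in(L^\infty)^*\colon E(X)\ge0\text{ whenever }X\ge0,\ E(\chi_\Omega)=1\}$ with the subspace topology. $\operatorname{CP}$ of a sequence in a topological space is its set of cluster points ($z$ is a cluster point iff every neighbourhood of $z$ contains terms of arbitrarily large index). Unconditional quantities: $\overline{R}(X)=\limsup_{n\to\infty}\frac1n\sum_{i=1}^nX(\vec{\Omega}(i))$ for $X\in L^\infty$, and $\underline{P}(B)=\liminf_{n\to\infty}\frac1n\sum_{i=1}^n\chi_B(\vec{\Omega}(i))$. Conditional upper prevision: let $B\subseteq\Omega$ be such that $\vec{\Omega}(i)\in B$ for at least one $i$, let $n_B$ be the smallest index with $\vec{\Omega}(n_B)\in B$, and define $\vec{E}(\cdot|B)\colon\mathbb{N}\to\operatorname{PF}(\Omega)$ by $\vec{E}(\cdot|B)(n)=\Big(X\mapsto\frac{\sum_{i=1}^n(X\cdot\chi_B)(\vec{\Omega}(i))}{\sum_{i=1}^n\chi_B(\vec{\Omega}(i))}\Big)$ for $n\ge n_B$, and $\vec{E}(\cdot|B)(n)=E_0$ for $n<n_B$, where $E_0\in\operatorname{PF}(\Omega)$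 is an arbitrary fixed element. Then $\overline{R}(X|B)=\sup\{\tilde E(X)\colon\tilde E\in\operatorname{CP}(\vec{E}(\cdot|B))\}$. Generalized Bayes rule: for $\underline{P}(B)>0$, let $\mathcal{D}_{\vec{\Omega}}=\{X\in L^\infty\colon\overline{R}(X)\le0\}$, $\mathcal{D}_{\vec{\Omega}|B}=\{X\in L^\infty\colon X\chi_B\in\mathcal{D}_{\vec{\Omega}}\}$, and $\operatorname{GBR}(X|B)=\inf\{\alpha\in\mathbb{R}\colon X-\alpha\in\mathcal{D}_{\vec{\Omega}|B}\}=\inf\{\alpha\in\mathbb{R}\colon\overline{R}(\chi_B(X-\alpha))\le0\}$. *)

theory Defs
  imports "HOL-Analysis.Analysis" "HOL-Probability.Discrete_Topology"
begin

text \<open>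
  The set \<open>\<Omega>\<close> is the type \<open>'a\<close>.  On a discrete space every function is continuous, so the bounded
  continuous functions on the discrete copy of \<open>'a\<close> are all bounded functions \<open>'a \<Rightarrow> real\<close>, and
  the library norm on them is the supremum norm.  Hence \<open>'a linf \<Rightarrow>\<^sub>L real\<close> is the dual of
  \<open>L\<^sup>\<infinity>\<close>.
\<close>

type_synonym 'a linf = "'a discrete \<Rightarrow>\<^sub>C real"

definition ev :: "'a linf \<Rightarrow> 'a \<Rightarrow> real"
  where "ev X w = apply_bcontfun X (discrete w)"

unbundle bcontfun.lifting

lemma continuous_on_discrete_copy: "continuous_on S (f :: 'a discrete \<Rightarrow> 'b::topological_space)"
  unfolding continuous_on_open_invariant using open_discrete by blast

lift_definition chi :: "'a set \<Rightarrow> 'a linf" is "\<lambda>A w. indicator A (of_discrete w)"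
  by (auto simp: bcontfun_def continuous_on_discrete_copy indicator_def bounded_iff intro!: exI[of _ 1])

lift_definition mult_linf :: "'a linf \<Rightarrow> 'a linf \<Rightarrow> 'a linf" is "\<lambda>X Y w. X w * Y w"
proof -
  fix X Y :: "'a discrete \<Rightarrow> real"
  assume "X \<in> bcontfun" "Y \<in> bcontfun"
  then obtain a b where "\<And>w. norm (X w) \<le> a" "\<And>w. norm (Y w) \<le> b"
    by (auto simp: bcontfun_def bounded_iff)
  then have "norm (X w * Y w) \<le> a * b" for w
    by (metis norm_mult mult_mono norm_ge_zero order_trans)
  then show "(\<lambda>w. X w * Y w) \<in> bcontfun"
    by (auto simp: bcontfun_def continuous_on_discrete_copy bounded_iff)
qed

lemma ev_chi [simp]: "ev (chi A) w = indicator A w"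
  by (simp add: ev_def chi.rep_eq discrete_inverse)

lemma ev_mult_linf [simp]: "ev (mult_linf X Y) w = ev X w * ev Y w"
  by (simp add: ev_def mult_linf.rep_eq)

lemma bounded_imp_ex_linf:
  assumes "bounded (range f)"
  shows "\<exists>X. \<forall>w. ev X w = f w"
proof -
  have "f \<circ> of_discrete \<in> bcontfun"
    using assms
    by (auto simp: bcontfun_def continuous_on_discrete_copy intro: bounded_subset)
  then show ?thesis
    by (intro exI[of _ "Bcontfun (f \<circ> of_discrete)"])
       (simp add: ev_def Bcontfun_inverse discrete_inverse)
qed

lemma bounded_linear_ev: "bounded_linear (\<lambda>X. ev X w)"
  by (rule bounded_linear_intro[of _ 1])
     (auto simp: ev_def norm_bounded simp del: real_norm_def simp flip: real_norm_def)

text \<open>The weak* topology is the coarsest one making all evaluations \<open>E \<mapsto> E X\<close> continuous.\<close>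

definition weak_star :: "('a linf \<Rightarrow>\<^sub>L real) topology"
  where "weak_star = pullback_topology UNIV blinfun_apply (product_topology (\<lambda>_. euclideanreal) UNIV)"

definition PF :: "('a linf \<Rightarrow>\<^sub>L real) set"
  where "PF = {E. (\<forall>X. (\<forall>w. ev X w \<ge> 0) \<longrightarrow> blinfun_apply E X \<ge> 0) \<and> blinfun_apply E (chi UNIV) = 1}"

definition PF_topology :: "('a linf \<Rightarrow>\<^sub>L real) topology"
  where "PF_topology = subtopology weak_star PF"

definition cluster_points :: "'b topology \<Rightarrow> (nat \<Rightarrow> 'b) \<Rightarrow> 'b set"
  where "cluster_points T s = {z \<in> topspace T.
    \<forall>N. N \<subseteq> topspace T \<and> (\<exists>U. openin T U \<and> z \<in> U \<and> U \<subseteq> N) \<longrightarrow> (\<forall>m. \<exists>n\<ge>m. s n \<in> N)}"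

text \<open>
  Sequences are indexed from 1: the value \<open>\<omega> 0\<close> is never used.  Upper and lower limits, suprema and
  infima are taken in \<open>ereal\<close>, where they always exist.
\<close>

definition upper_R :: "(nat \<Rightarrow> 'a) \<Rightarrow> 'a linf \<Rightarrow> ereal"
  where "upper_R \<omega> X = limsup (\<lambda>n. ereal (1 / real n * (\<Sum>i=1..n. ev X (\<omega> i))))"

definition lower_P :: "(nat \<Rightarrow> 'a) \<Rightarrow> 'a set \<Rightarrow> ereal"
  where "lower_P \<omega> B = liminf (\<lambda>n. ereal (1 / real n * (\<Sum>i=1..n. ev (chi B) (\<omega> i))))"

lift_definition cond_mean :: "(nat \<Rightarrow> 'a) \<Rightarrow> 'a set \<Rightarrow> nat \<Rightarrow> 'a linf \<Rightarrow>\<^sub>L real"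
  is "\<lambda>\<omega> B n X. (\<Sum>i=1..n. ev (mult_linf X (chi B)) (\<omega> i)) / (\<Sum>i=1..n. ev (chi B) (\<omega> i))"
  unfolding ev_mult_linf
  by (intro bounded_linear_divide[THEN bounded_linear_compose] bounded_linear_sum
        bounded_linear_mult_left[THEN bounded_linear_compose] bounded_linear_ev)

definition first_hit :: "(nat \<Rightarrow> 'a) \<Rightarrow> 'a set \<Rightarrow> nat"
  where "first_hit \<omega> B = (LEAST i. 1 \<le> i \<and> \<omega> i \<in> B)"

definition cond_seq :: "('a linf \<Rightarrow>\<^sub>L real) \<Rightarrow> (nat \<Rightarrow> 'a) \<Rightarrow> 'a set \<Rightarrow> nat \<Rightarrow> 'a linf \<Rightarrow>\<^sub>L real"
  where "cond_seq E0 \<omega> B n = (if first_hit \<omega> B \<le> n then cond_mean \<omega> B n else E0)"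

lemma cond_seq_in_PF:
  assumes "E0 \<in> PF" "1 \<le> j" "\<omega> j \<in> B"
  shows "cond_seq E0 \<omega> B n \<in> PF"
proof (cases "first_hit \<omega> B \<le> n")
  case True
  let ?k = "first_hit \<omega> B"
  have k: "1 \<le> ?k \<and> \<omega> ?k \<in> B"
    unfolding first_hit_def by (rule LeastI[of _ j]) (use assms in auto)
  have "0 < (\<Sum>i=1..n. ev (chi B) (\<omega> i))"
    by (rule sum_pos2[of _ ?k]) (use k True in auto)
  moreover have "ev (mult_linf (chi UNIV) (chi B)) w = ev (chi B) w" for w
    by simp
  moreover have "0 \<le> ev (mult_linf X (chi B)) w" if "\<forall>w. 0 \<le> ev X w" for X w
    using that by simp
  ultimately show ?thesis
    using True
    by (simp del: ev_chi ev_mult_linf add: cond_seq_def PF_def cond_mean.rep_eq divide_nonneg_pos sum_nonneg)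
qed (use assms in \<open>simp add: cond_seq_def\<close>)

definition upper_R_cond :: "('a linf \<Rightarrow>\<^sub>L real) \<Rightarrow> (nat \<Rightarrow> 'a) \<Rightarrow> 'a linf \<Rightarrow> 'a set \<Rightarrow> ereal"
  where "upper_R_cond E0 \<omega> X B =
    (SUP E \<in> cluster_points PF_topology (cond_seq E0 \<omega> B). ereal (blinfun_apply E X))"

definition desirable :: "(nat \<Rightarrow> 'a) \<Rightarrow> 'a linf set"
  where "desirable \<omega> = {X. upper_R \<omega> X \<le> 0}"

definition desirable_cond :: "(nat \<Rightarrow> 'a) \<Rightarrow> 'a set \<Rightarrow> 'a linf set"
  where "desirable_cond \<omega> B = {X. mult_linf X (chi B) \<in> desirable \<omega>}"

definition GBR :: "(nat \<Rightarrow> 'a) \<Rightarrow> 'a linf \<Rightarrow> 'a set \<Rightarrow> ereal"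
  where "GBR \<omega> X B = Inf (ereal ` {\<alpha>. X - const_bcontfun \<alpha> \<in> desirable_cond \<omega> B})"

end

theory Submission
  imports Defs
begin

text \<open>
  Both sides equal the upper limit of the conditional means
  \<open>m n = (\<Sum>i=1..n. (X \<chi>\<^sub>B) (\<omega> i)) / (\<Sum>i=1..n. \<chi>\<^sub>B (\<omega> i))\<close>.  For the upper prevision, weak*
  compactness of the set of linear previsions provides a cluster point along any infinite set of
  indices where \<open>m n > c\<close>.  For the generalized Bayes rule, the means of \<open>\<chi>\<^sub>B (X - \<alpha>)\<close> are
  \<open>q n * (m n - \<alpha>)\<close>, where \<open>q n\<close> is the relative frequency of \<open>B\<close>; since \<open>q n\<close> is
  eventually bounded away from 0, their upper limit is at most 0 iff \<open>limsup m \<le> \<alpha>\<close>.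
\<close>

section \<open>Evaluations and the norm bound for positive normalized functionals\<close>

lemma ev_add [simp]: "ev (X + Y) w = ev X w + ev Y w"
  by (rule bounded_linear.linear[OF bounded_linear_ev, THEN linear_add])

lemma ev_diff [simp]: "ev (X - Y) w = ev X w - ev Y w"
  by (rule bounded_linear.linear[OF bounded_linear_ev, THEN linear_diff])

lemma ev_scaleR [simp]: "ev (c *\<^sub>R X) w = c * ev X w"
  by (simp add: ev_def)

lemma ev_const [simp]: "ev (const_bcontfun c) w = c"
  by (simp add: ev_def const_bcontfun.rep_eq)

lemma abs_ev_le_norm: "\<bar>ev X w\<bar> \<le> norm X"
  unfolding ev_def by (metis norm_bounded real_norm_def)

text \<open>Both \<open>norm X *\<^sub>R chi UNIV - X\<close> and
  \<open>norm X *\<^sub>R chi UNIV + X\<close> are pointwise nonnegative. Continuity of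
  \<open>f\<close> is a consequence here, so the bound also serves for a limit function that is only
  known to be linear.\<close>

lemma positive_normalized_abs_le:
  fixes f :: "'a linf \<Rightarrow> real"
  assumes lin: "linear f"
    and pos: "\<And>X. (\<And>w. 0 \<le> ev X w) \<Longrightarrow> 0 \<le> f X"
    and one: "f (chi UNIV) = 1"
  shows "\<bar>f X\<bar> \<le> norm X"
proof -
  have "0 \<le> norm X - ev X w" "0 \<le> norm X + ev X w" for w
    using abs_ev_le_norm[of X w] by linarith+
  then have "0 \<le> f (norm X *\<^sub>R chi UNIV - X)" "0 \<le> f (norm X *\<^sub>R chi UNIV + X)"
    by (auto intro!: pos)
  then show ?thesis
    by (simp add: linear_diff[OF lin] linear_add[OF lin] linear_scale[OF lin] one)
qed

lemma PF_abs_le: "E \<in> PF \<Longrightarrow> \<bar>blinfun_apply E X\<bar> \<le> norm X"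
  by (rule positive_normalized_abs_le)
     (auto simp: PF_def bounded_linear.linear blinfun.bounded_linear_right)

section \<open>Weak* compactness of the linear previsions\<close>

lemma openin_PF_topology:
  "openin PF_topology U \<longleftrightarrow> (\<exists>V. open V \<and> U = blinfun_apply -` V \<inter> PF)"
  unfolding PF_topology_def weak_star_def euclidean_product_topology openin_subtopology
    openin_pullback_topology by auto

lemma topspace_PF_topology [simp]: "topspace PF_topology = PF"
  by (simp add: PF_topology_def weak_star_def topspace_pullback_topology)

text \<open>Tychonoff's theorem for a product of compact intervals, as in Banach-Alaoglu. Members of
  the box need not be linear.\<close>

lemma compact_norm_box: "compact {f :: 'b::real_normed_vector \<Rightarrow> real. \<forall>x. \<bar>f x\<bar> \<le> norm x}"
proof -
  have "compactin (product_topology (\<lambda>_. euclideanreal) UNIV)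
      (PiE UNIV (\<lambda>x::'b. {- norm x .. norm x}))"
    by (simp add: compactin_PiE)
  moreover have "PiE UNIV (\<lambda>x::'b. {- norm x .. norm x}) = {f. \<forall>x. \<bar>f x\<bar> \<le> norm x}"
    by (auto simp: PiE_def Pi_def abs_le_iff minus_le_iff)
  ultimately show ?thesis
    by (simp add: euclidean_product_topology)
qed

text \<open>Weak* compactness need not give convergent subsequences, so the restriction to the
  indices satisfying \<open>P\<close> is made with a filter.\<close>

lemma PF_cluster_point_along:
  assumes PF: "\<And>n. s n \<in> PF" and freq: "\<exists>\<^sub>F n in sequentially. P n"
  shows "\<exists>E\<in>PF. \<forall>U. openin PF_topology U \<longrightarrow> E \<in> U \<longrightarrow> (\<exists>\<^sub>F n in sequentially. P n \<and> s n \<in> U)"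
proof -
  define F where "F = filtermap (\<lambda>n. blinfun_apply (s n)) (inf sequentially (principal (Collect P)))"
  have ev_F: "eventually Q F \<longleftrightarrow> (\<forall>\<^sub>F n in sequentially. P n \<longrightarrow> Q (blinfun_apply (s n)))" for Q
    by (simp add: F_def eventually_filtermap eventually_inf_principal)
  have "F \<noteq> bot"
    using freq by (simp add: trivial_limit_def ev_F frequently_def)
  moreover have "eventually (\<lambda>f. f \<in> {f. \<forall>x. \<bar>f x\<bar> \<le> norm x}) F"
    by (simp add: ev_F PF_abs_le[OF PF])
  \<comment> \<open>The cluster point is found in the space of all functions; linearity, positivity
    and normalization of \<open>f\<close> are recovered below.\<close>
  ultimately obtain f where f: "inf (nhds f) F \<noteq> bot"
    by (rule compact_norm_box[unfolded compact_filter, rule_format, THEN bexE])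
  have near: "\<exists>\<^sub>F n in sequentially. P n \<and> blinfun_apply (s n) \<in> V" if "open V" "f \<in> V" for V
  proof (rule ccontr)
    assume "\<not> ?thesis"
    then have "eventually (\<lambda>g. g \<notin> V) F"
      by (simp add: ev_F not_frequently)
    moreover have "eventually (\<lambda>g. g \<in> V) (nhds f)"
      using that by (simp add: eventually_nhds_in_open)
    ultimately have "eventually (\<lambda>_. False) (inf (nhds f) F)"
      unfolding eventually_inf by (intro exI[of _ "\<lambda>g. g \<in> V"] exI[of _ "\<lambda>g. g \<notin> V"]) simp
    with f show False
      by (simp add: trivial_limit_def)
  qed
  \<comment> \<open>A closed set containing all terms contains \<open>f\<close>, since its
    complement would be a neighbourhood of \<open>f\<close> that no term enters. Each defining
    property of a linear prevision, for fixed arguments, is such a closed condition on finitely many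
    coordinates.\<close>
  have closed: "f \<in> C" if "closed C" "\<And>n. blinfun_apply (s n) \<in> C" for C
    using near[of "- C"] that by (auto simp: open_Compl)
  have coord: "continuous_on UNIV (\<lambda>g :: 'a linf \<Rightarrow> real. g X)" for X
    by (rule continuous_on_product_coordinates)
  note closed_intros = closed_Collect_le closed_Collect_eq coord continuous_on_const
    continuous_on_add continuous_on_mult
  have pos: "0 \<le> f X" if "\<And>w. 0 \<le> ev X w" for X
  proof -
    have "closed {g :: 'a linf \<Rightarrow> real. 0 \<le> g X}"
      by (intro closed_intros)
    from closed[OF this] show ?thesis
      using PF that by (simp add: PF_def)
  qed
  have "closed {g :: 'a linf \<Rightarrow> real. g (chi UNIV) = 1}"
    by (intro closed_intros)
  from closed[OF this] have one: "f (chi UNIV) = 1"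
    using PF by (simp add: PF_def)
  have "f (X + Y) = f X + f Y" for X Y
  proof -
    have "closed {g :: 'a linf \<Rightarrow> real. g (X + Y) = g X + g Y}"
      by (intro closed_intros)
    from closed[OF this] show ?thesis
      by (simp add: blinfun.add_right)
  qed
  moreover have "f (c *\<^sub>R X) = c * f X" for c X
  proof -
    have "closed {g :: 'a linf \<Rightarrow> real. g (c *\<^sub>R X) = c * g X}"
      by (intro closed_intros)
    from closed[OF this] show ?thesis
      by (simp add: blinfun.scaleR_right)
  qed
  ultimately have lin: "linear f"
    by (simp add: linear_iff)
  have "bounded_linear f"
    using positive_normalized_abs_le[OF lin pos one] linear_add[OF lin] linear_scale[OF lin]
    by (intro bounded_linear_intro[of f 1]) simp_all
  then have Bf: "blinfun_apply (Blinfun f) = f"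
    by (rule bounded_linear_Blinfun_apply)
  show ?thesis
  proof (intro bexI allI impI)
    show "Blinfun f \<in> PF"
      using pos one by (simp add: PF_def Bf)
    fix U :: "('a linf \<Rightarrow>\<^sub>L real) set"
    assume "openin PF_topology U" "Blinfun f \<in> U"
    then obtain V where V: "open V" "U = blinfun_apply -` V \<inter> PF" "f \<in> V"
      by (auto simp: openin_PF_topology Bf)
    with near[of V] PF show "\<exists>\<^sub>F n in sequentially. P n \<and> s n \<in> U"
      by simp
  qed
qed

section \<open>Cluster points and the conditional upper prevision\<close>

lemma openin_PF_greater: "openin PF_topology {E \<in> PF. c < blinfun_apply E X}"
  unfolding openin_PF_topology
  by (rule exI[of _ "{f. c < f X}"])
     (auto intro!: open_Collect_less continuous_on_product_coordinates continuous_intros)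

lemma openin_PF_less: "openin PF_topology {E \<in> PF. blinfun_apply E X < c}"
  unfolding openin_PF_topology
  by (rule exI[of _ "{f. f X < c}"])
     (auto intro!: open_Collect_less continuous_on_product_coordinates continuous_intros)

text \<open>Every neighbourhood contains an open one, so open sets suffice; the frequency quantifier
  makes the filter rules available.\<close>

lemma cluster_points_PF_iff:
  "E \<in> cluster_points PF_topology s \<longleftrightarrow>
    E \<in> PF \<and> (\<forall>U. openin PF_topology U \<longrightarrow> E \<in> U \<longrightarrow> (\<exists>\<^sub>F n in sequentially. s n \<in> U))"
proof
  assume "E \<in> cluster_points PF_topology s"
  then have "E \<in> PF" and near: "\<And>N. N \<subseteq> PF \<and> (\<exists>U. openin PF_topology U \<and> E \<in> U \<and> U \<subseteq> N) \<Longrightarrow>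
      \<forall>m. \<exists>n\<ge>m. s n \<in> N"
    by (simp_all add: cluster_points_def)
  moreover have "\<forall>m. \<exists>n\<ge>m. s n \<in> U" if "openin PF_topology U" "E \<in> U" for U
    by (rule near) (use that openin_subset[OF that(1)] in auto)
  ultimately show "E \<in> PF \<and> (\<forall>U. openin PF_topology U \<longrightarrow> E \<in> U \<longrightarrow> (\<exists>\<^sub>F n in sequentially. s n \<in> U))"
    by (simp add: frequently_sequentially)
next
  assume R: "E \<in> PF \<and> (\<forall>U. openin PF_topology U \<longrightarrow> E \<in> U \<longrightarrow> (\<exists>\<^sub>F n in sequentially. s n \<in> U))"
  show "E \<in> cluster_points PF_topology s"
    unfolding cluster_points_def frequently_sequentially[symmetric]
  proof (intro CollectI conjI allI impI)
    show "E \<in> topspace PF_topology" using R by simp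
    fix N assume "N \<subseteq> topspace PF_topology \<and> (\<exists>U. openin PF_topology U \<and> E \<in> U \<and> U \<subseteq> N)"
    then obtain U where U: "openin PF_topology U" "E \<in> U" "U \<subseteq> N" by (elim conjE exE)
    then have "\<exists>\<^sub>F n in sequentially. s n \<in> U" using R by simp
    then show "\<exists>\<^sub>F n in sequentially. s n \<in> N"
      by (rule frequently_elim1) (use U in auto)
  qed
qed

lemma SUP_cluster_points_PF:
  assumes PF: "\<And>n. s n \<in> PF"
  shows "(SUP E \<in> cluster_points PF_topology s. ereal (blinfun_apply E X))
    = limsup (\<lambda>n. ereal (blinfun_apply (s n) X))" (is "?S = ?L")
proof (rule antisym)
  show "?S \<le> ?L"
  proof (rule SUP_least, rule ccontr)
    fix E assume E: "E \<in> cluster_points PF_topology s"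
    assume "\<not> ereal (blinfun_apply E X) \<le> ?L"
    \<comment> \<open>The open condition that the value at \<open>X\<close> exceeds \<open>c\<close>
      would hold for infinitely many terms, although the values at \<open>X\<close> are eventually
      below \<open>c\<close>.\<close>
    then obtain c where c: "?L < ereal c" "ereal c < ereal (blinfun_apply E X)"
      by (meson ereal_dense2 not_le)
    then have "E \<in> {E \<in> PF. c < blinfun_apply E X}"
      using E by (simp add: cluster_points_PF_iff)
    then have "\<exists>\<^sub>F n in sequentially. s n \<in> {E \<in> PF. c < blinfun_apply E X}"
      using E openin_PF_greater[of c X] by (simp only: cluster_points_PF_iff)
    moreover have "\<forall>\<^sub>F n in sequentially. blinfun_apply (s n) X < c"
      using Limsup_lessD[OF c(1)] by simp
    ultimately have "\<exists>\<^sub>F n in sequentially. False"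
      by (elim frequently_rev_mp) (auto elim!: eventually_mono)
    then show False by simp
  qed
  show "?L \<le> ?S"
  proof (rule ccontr)
    assume "\<not> ?L \<le> ?S"
    then obtain c where c: "?S < ereal c" "ereal c < ?L"
      by (meson ereal_dense2 not_le)
    have "\<exists>\<^sub>F n in sequentially. c < blinfun_apply (s n) X"
    proof (rule ccontr)
      assume "\<not> ?thesis"
      then have "?L \<le> ereal c"
        by (intro Limsup_bounded) (simp add: not_frequently not_less)
      with c(2) show False by simp
    qed
    from PF_cluster_point_along[of s, OF PF this]
    obtain E where E: "E \<in> PF" and near: "\<forall>U. openin PF_topology U \<longrightarrow> E \<in> U \<longrightarrow>
        (\<exists>\<^sub>F n in sequentially. c < blinfun_apply (s n) X \<and> s n \<in> U)"
      by (elim bexE)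
    have "E \<in> cluster_points PF_topology s"
      unfolding cluster_points_PF_iff
    proof (intro conjI allI impI)
      fix U assume "openin PF_topology U" "E \<in> U"
      from near[rule_format, OF this] show "\<exists>\<^sub>F n in sequentially. s n \<in> U"
        by (rule frequently_elim1) simp
    qed (fact E)
    then have "ereal (blinfun_apply E X) \<le> ?S"
      by (rule SUP_upper)
    also note c(1)
    finally have "blinfun_apply E X < c" by simp
    \<comment> \<open>This open set around \<open>E\<close> would have to contain terms whose value
      at \<open>X\<close> is above \<open>c\<close>.\<close>
    then have "E \<in> {E \<in> PF. blinfun_apply E X < c}"
      using E by simp
    from near[rule_format, OF openin_PF_less this] have "\<exists>\<^sub>F n in sequentially. False"
      by (rule frequently_elim1) auto
    then show False by simp
  qed
qed

section \<open>Upper limits and the generalized Bayes rule\<close>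

lemma limsup_mult_diff_le_0_iff:
  fixes q m :: "nat \<Rightarrow> real" and \<alpha> :: real
  assumes q1: "\<And>n. q n \<le> 1" and q: "0 < liminf (\<lambda>n. ereal (q n))"
  shows "limsup (\<lambda>n. ereal (q n * (m n - \<alpha>))) \<le> 0 \<longleftrightarrow> limsup (\<lambda>n. ereal (m n)) \<le> ereal \<alpha>"
proof -
  have limsup_le: "limsup (\<lambda>n. ereal (f n)) \<le> ereal a \<longleftrightarrow>
      (\<forall>e>0. \<forall>\<^sub>F n in sequentially. f n < a + e)" for f :: "nat \<Rightarrow> real" and a
  proof
    assume L: "limsup (\<lambda>n. ereal (f n)) \<le> ereal a"
    show "\<forall>e>0. \<forall>\<^sub>F n in sequentially. f n < a + e"
    proof (intro allI impI)
      fix e :: real assume "e > 0"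
      then have "limsup (\<lambda>n. ereal (f n)) < ereal (a + e)"
        using L by (simp add: le_less_trans)
      from Limsup_lessD[OF this] show "\<forall>\<^sub>F n in sequentially. f n < a + e" by simp
    qed
  next
    assume *: "\<forall>e>0. \<forall>\<^sub>F n in sequentially. f n < a + e"
    show "limsup (\<lambda>n. ereal (f n)) \<le> ereal a"
    proof (rule ereal_le_epsilon2)
      fix e :: real assume "e > 0"
      then have "\<forall>\<^sub>F n in sequentially. f n < a + e" using * by blast
      then show "limsup (\<lambda>n. ereal (f n)) \<le> ereal a + ereal e"
        by (intro Limsup_bounded) (auto elim!: eventually_mono)
    qed
  qed
  \<comment> \<open>Any real strictly between 0 and the lower limit is an eventual lower bound for
    \<open>q\<close>.\<close>
  obtain d where d: "0 < d" "ereal d < liminf (\<lambda>n. ereal (q n))"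
    using ereal_dense2[OF q] by auto
  from less_LiminfD[OF d(2)] have qd: "\<forall>\<^sub>F n in sequentially. d < q n"
    by simp
  show ?thesis
    unfolding limsup_le limsup_le[of _ 0, folded zero_ereal_def]
  proof (intro iffI allI impI)
    fix e :: real
    assume *: "\<forall>e>0. \<forall>\<^sub>F n in sequentially. q n * (m n - \<alpha>) < 0 + e" and "0 < e"
    \<comment> \<open>The tolerance is scaled by \<open>d\<close>, so that cancelling a factor
      \<open>q n > d\<close> leaves at most \<open>e\<close>.\<close>
    then have "\<forall>\<^sub>F n in sequentially. q n * (m n - \<alpha>) < 0 + d * e"
      using d(1) by simp
    with qd show "\<forall>\<^sub>F n in sequentially. m n < \<alpha> + e"
    proof eventually_elim
      case (elim n)
      show ?case
      proof (rule ccontr)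
        assume "\<not> ?thesis"
        then have "d * e \<le> q n * (m n - \<alpha>)"
          using elim(1) d(1) \<open>0 < e\<close> by (intro mult_mono) auto
        with elim(2) show False by simp
      qed
    qed
  next
    fix e :: real
    assume "\<forall>e>0. \<forall>\<^sub>F n in sequentially. m n < \<alpha> + e" and "0 < e"
    then have "\<forall>\<^sub>F n in sequentially. m n < \<alpha> + e" by simp
    with qd show "\<forall>\<^sub>F n in sequentially. q n * (m n - \<alpha>) < 0 + e"
    proof eventually_elim
      case (elim n)
      then have "q n * (m n - \<alpha>) < q n * e"
        using d(1) by (intro mult_strict_left_mono) auto
      \<comment> \<open>The converse direction needs the upper bound 1 on \<open>q\<close>.\<close>
      also have "\<dots> \<le> e"
        using q1[of n] \<open>0 < e\<close> by simp
      finally show ?case by simp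
    qed
  qed
qed

text \<open>Reals are dense in \<open>ereal\<close>. Infinite \<open>L\<close> is covered too, so
  finiteness of the upper limit need not be checked; for \<open>L = \<infinity>\<close> the infimum
  is over the empty set.\<close>

lemma Inf_ereal_above: "Inf (ereal ` {\<alpha>. L \<le> ereal \<alpha>}) = L"
proof (rule antisym)
  show "Inf (ereal ` {\<alpha>. L \<le> ereal \<alpha>}) \<le> L"
  proof (rule ccontr)
    assume "\<not> ?thesis"
    then obtain c where "L < ereal c" "ereal c < Inf (ereal ` {\<alpha>. L \<le> ereal \<alpha>})"
      by (meson ereal_dense2 not_le)
    moreover from this have "Inf (ereal ` {\<alpha>. L \<le> ereal \<alpha>}) \<le> ereal c"
      by (intro Inf_lower) auto
    ultimately show False by simp
  qed
qed (auto intro: Inf_greatest)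

lemma GBR_eq_limsup_cond_mean:
  assumes "lower_P \<omega> B > 0"
  shows "GBR \<omega> X B = limsup (\<lambda>n. ereal (blinfun_apply (cond_mean \<omega> B n) X))"
proof -
  define q where "q n = 1 / real n * (\<Sum>i=1..n. ev (chi B) (\<omega> i))" for n
  define m where "m n = blinfun_apply (cond_mean \<omega> B n) X" for n
  have "(\<Sum>i=1..n. ev (chi B) (\<omega> i)) \<le> real n" for n
    using sum_bounded_above[of "{1..n}" "\<lambda>i. ev (chi B) (\<omega> i)" 1] by (simp add: indicator_def)
  then have q1: "q n \<le> 1" for n
    by (cases "n = 0") (auto simp: q_def divide_le_eq)
  have q0: "0 < liminf (\<lambda>n. ereal (q n))"
    using assms by (simp add: lower_P_def q_def)
  \<comment> \<open>This holds even before the first visit to \<open>B\<close>: then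
    \<open>q n\<close> is 0, the sum on the left vanishes, and \<open>m n\<close> is 0 by division
    by zero.\<close>
  have mean: "1 / real n * (\<Sum>i=1..n. ev (mult_linf (X - const_bcontfun \<alpha>) (chi B)) (\<omega> i))
      = q n * (m n - \<alpha>)" for n \<alpha>
  proof -
    let ?S = "\<Sum>i=1..n. ev (chi B) (\<omega> i)"
    let ?T = "\<Sum>i=1..n. ev (mult_linf X (chi B)) (\<omega> i)"
    have "(\<Sum>i=1..n. ev (mult_linf (X - const_bcontfun \<alpha>) (chi B)) (\<omega> i)) = ?T - \<alpha> * ?S"
      by (simp add: left_diff_distrib sum_subtractf sum_distrib_left)
    \<comment> \<open>A vanishing sum of indicators means that no index up to \<open>n\<close> hits
      \<open>B\<close>.\<close>
    moreover have "?T = 0" if "?S = 0"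
    proof -
      have "\<forall>i\<in>{1..n}. ev (chi B) (\<omega> i) = 0"
        using that by (subst (asm) sum_nonneg_eq_0_iff) auto
      then show ?thesis
        by (intro sum.neutral) simp
    qed
    moreover have "m n = ?T / ?S"
      by (simp only: m_def cond_mean.rep_eq)
    moreover have "?S * (?T / ?S - \<alpha>) = ?T - \<alpha> * ?S" if "?S \<noteq> 0"
      using that by (simp add: right_diff_distrib mult.commute)
    ultimately have "(\<Sum>i=1..n. ev (mult_linf (X - const_bcontfun \<alpha>) (chi B)) (\<omega> i))
        = ?S * (m n - \<alpha>)"
      by (cases "?S = 0") (metis mult_zero_left mult_zero_right diff_0_right, metis)
    then show ?thesis
      by (simp only: q_def mult.assoc)
  qed
  have "GBR \<omega> X B = Inf (ereal ` {\<alpha>. limsup (\<lambda>n. ereal (m n)) \<le> ereal \<alpha>})"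
    by (simp only: GBR_def desirable_cond_def desirable_def upper_R_def mem_Collect_eq mean
        limsup_mult_diff_le_0_iff[OF q1 q0])
  then show ?thesis
    by (simp add: Inf_ereal_above m_def)
qed

text \<open>Without a visit at an index from 1 on, all relative frequencies are 0. The visit ensures
  that the conditional sequence stays in \<open>PF\<close>.\<close>

lemma lower_P_pos_imp_hit:
  assumes "lower_P \<omega> B > 0"
  obtains j where "1 \<le> j" "\<omega> j \<in> B"
proof (rule ccontr)
  assume "\<not> thesis"
  then have "\<omega> i \<notin> B" if "1 \<le> i" for i
    using that \<open>\<And>j. 1 \<le> j \<Longrightarrow> \<omega> j \<in> B \<Longrightarrow> thesis\<close> by blast
  then have "lower_P \<omega> B = 0"
    by (simp add: lower_P_def zero_ereal_def Liminf_const)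
  with assms show False by simp
qed

theorem proposition4p7:
  fixes \<omega> :: "nat \<Rightarrow> 'a" and B :: "'a set" and E0 :: "'a linf \<Rightarrow>\<^sub>L real" and X :: "'a linf"
  assumes "E0 \<in> PF"
    and "lower_P \<omega> B > 0"
  shows "upper_R_cond E0 \<omega> X B = GBR \<omega> X B"
proof -
  obtain j where "1 \<le> j" "\<omega> j \<in> B"
    using lower_P_pos_imp_hit[OF assms(2)] .
  then have "upper_R_cond E0 \<omega> X B = limsup (\<lambda>n. ereal (blinfun_apply (cond_seq E0 \<omega> B n) X))"
    unfolding upper_R_cond_def using assms(1) by (intro SUP_cluster_points_PF cond_seq_in_PF)
  \<comment> \<open>The value \<open>E0\<close> occurs only below
    \<open>first_hit \<omega> B\<close>, and finitely many terms do not change an upper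
    limit.\<close>
  also have "\<dots> = limsup (\<lambda>n. ereal (blinfun_apply (cond_mean \<omega> B n) X))"
    by (intro Limsup_eq eventually_sequentiallyI[of "first_hit \<omega> B"]) (simp add: cond_seq_def)
  also have "\<dots> = GBR \<omega> X B"
    by (rule GBR_eq_limsup_cond_mean[OF assms(2), symmetric])
  finally show ?thesis .
qed

end
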